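(* Let $k,\ell$ be non-negative integers, $m=k+\ell$, $A\in\mathbb{R}^{k\times k}$, $B\in\mathbb{R}^{k\times\ell}$, $C\in\mathbb{R}^{\ell\times k}$, $D\in\mathbb{R}^{\ell\times\ell}$, $p\in\mathbb{R}^k$, $q\in\mathbb{R}^\ell$, and let $\widetilde F_1$, $\widetilde F_2$ and $\mathbb{F}:\mathbb{R}^{m+1}\to\mathbb{R}^{m+1}$ be the maps defined in the context. Let $z^*=(x^*,u^*,t^* )\in\text{SOL-MixCP}(\widetilde F_1,\widetilde F_2,\mathbb{R}^k_+)$ be such that $(x_i^*,\widetilde F_1^i(z^* ))\neq(0,0)$ for all $i=1,\dots,k$, and suppose that the Jacobian matrix $\mathcal{A}(z^* )$ of $\mathbb{F}$ at $z^*$ is nonsingular. Then Newton's method $$z^{j+1}=z^j-\mathcal{A}(z^j)^{-1}\,\mathbb{F}(z^j),\qquad j=0,1,2,\dots,$$ converges at least quadratically to $z^*$ if it starts sufficiently close to $z^*$; that is, there exist $\rho>0$ and $c>0$ such that for every $z^0$ with $\|z^0-z^*\|<\rho$ all iterates are well defined, $z^j\to z^*$, and $\|z^{j+1}-z^*\|\le c\,\|z^j-z^*\|^2$ for all $j\ge0$.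
   Context: Points of $\mathbb{R}^{m+1}$ are written $z=(x,u,t)$ with $x\in\mathbb{R}^k$, $u\in\mathbb{R}^\ell$, $t\in\mathbb{R}$; $e=(1,\dots,1)^\top\in\mathbb{R}^k$; $\|\cdot\|$ is the Euclidean norm. Define $\widetilde F_1:\mathbb{R}^{m+1}\to\mathbb{R}^k$ and $\widetilde F_2:\mathbb{R}^{m+1}\to\mathbb{R}^{\ell+1}$ by $$\widetilde F_1(x,u,t)=A(x+te)+Bu+p,\qquad \widetilde F_2(x,u,t)=\begin{pmatrix}(tC+ue^\top A)(x+te)+ue^\top(Bu+p)+t(Du+q)\\ t^2-\|u\|^2\end{pmatrix},$$ and let $\widetilde F_1^i$ be the $i$-th component of $\widetilde F_1$. The set $\text{SOL-MixCP}(\widetilde F_1,\widetilde F_2,\mathbb{R}^k_+)$ consists of all $z=(x,u,t)\in\mathbb{R}^{m+1}$ with $\widetilde F_2(z)=0$, $x\ge0$, $\widetilde F_1(z)\ge0$ (componentwise) and $\langle x,\widetilde F_1(z)\rangle=0$. The Fischer-Burmeister function is $\psi(a,b)=\sqrt{a^2+b^2}-(a+b)$ for $(a,b)\in\mathbb{R}^2$, and $$\mathbb{F}(x,u,t)=\begin{pmatrix}\psi(x_1,\widetilde F_1^1(x,u,t))\\ \vdots\\ \psi(x_k,\widetilde F_1^k(x,u,t))\\ \widetilde F_2(x,u,t)\end{pmatrix}.$$ $\mathcal{A}(z)$ denotes the $(m+1)\times(m+1)$ Jacobian matrix of $\mathbb{F}$ at $z$; it exists at every $z$ with $(x_i,\widetilde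 F_1^i(z))\ne(0,0)$ for all $i=1,\dots,k$. *)

theory Defs
  imports "HOL-Analysis.Analysis" "Jordan_Normal_Form.Matrix"
begin

unbundle no vec_syntax
no_notation inner (infix "\<bullet>" 70)

text \<open>
  The sizes \<open>k\<close> and \<open>l\<close> are natural numbers and may be \<open>0\<close>, which no index type can express
  because types are nonempty. The data \<open>A, B, C, D, p, q\<close> and the blocks \<open>x, u\<close> are therefore
  matrices and vectors with explicit dimensions. The ambient space, whose dimension
  \<open>k + l + 1\<close> is positive, is \<open>real ^ 'n\<close>, so that norm, convergence, differentiability and
  Jacobian are those of the analysis library. An enumeration \<open>ix\<close>, a bijection from
  \<open>{..<k + l + 1}\<close> onto the index type, fixes the order of the coordinates in \<open>z = (x, u, t)\<close>.
\<close>

definition x_part :: "(nat \<Rightarrow> 'n) \<Rightarrow> nat \<Rightarrow> real ^ 'n \<Rightarrow> real Matrix.vec" where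
  "x_part ix k z = Matrix.vec k (\<lambda>i. vec_nth z (ix i))"

definition u_part :: "(nat \<Rightarrow> 'n) \<Rightarrow> nat \<Rightarrow> nat \<Rightarrow> real ^ 'n \<Rightarrow> real Matrix.vec" where
  "u_part ix k l z = Matrix.vec l (\<lambda>i. vec_nth z (ix (k + i)))"

definition t_part :: "(nat \<Rightarrow> 'n) \<Rightarrow> nat \<Rightarrow> nat \<Rightarrow> real ^ 'n \<Rightarrow> real" where
  "t_part ix k l z = vec_nth z (ix (k + l))"

text \<open>The vector of \<open>real ^ 'n\<close> whose coordinate number \<open>j\<close>, for \<open>j < d\<close>, is \<open>v $ j\<close>.\<close>

definition of_coords :: "(nat \<Rightarrow> 'n) \<Rightarrow> nat \<Rightarrow> real Matrix.vec \<Rightarrow> real ^ 'n" where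
  "of_coords ix d v = vec_lambda (\<lambda>i. v $ the_inv_into {..<d} ix i)"

definition ones :: "nat \<Rightarrow> real Matrix.vec" where
  "ones k = Matrix.vec k (\<lambda>_. 1)"

text \<open>The outer product of \<open>v\<close> and \<open>w\<close>, that is, the matrix \<open>v w\<^sup>T\<close>.\<close>

definition outer :: "real Matrix.vec \<Rightarrow> real Matrix.vec \<Rightarrow> real Matrix.mat" where
  "outer v w = Matrix.mat (dim_vec v) (dim_vec w) (\<lambda>(i, j). v $ i * w $ j)"

definition F1 ::
  "real Matrix.mat \<Rightarrow> real Matrix.mat \<Rightarrow> real Matrix.vec \<Rightarrow>
   real Matrix.vec \<Rightarrow> real Matrix.vec \<Rightarrow> real \<Rightarrow> real Matrix.vec" where
  "F1 A B p x u t = A *\<^sub>v (x + t \<cdot>\<^sub>v ones (dim_vec x)) + B *\<^sub>v u + p"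

definition F2 ::
  "real Matrix.mat \<Rightarrow> real Matrix.mat \<Rightarrow> real Matrix.mat \<Rightarrow> real Matrix.mat \<Rightarrow>
   real Matrix.vec \<Rightarrow> real Matrix.vec \<Rightarrow>
   real Matrix.vec \<Rightarrow> real Matrix.vec \<Rightarrow> real \<Rightarrow> real Matrix.vec" where
  "F2 A B C D p q x u t =
     (let e = ones (dim_vec x); ueT = outer u e in
      ((t \<cdot>\<^sub>m C + ueT * A) *\<^sub>v (x + t \<cdot>\<^sub>v e) + ueT *\<^sub>v (B *\<^sub>v u + p) + t \<cdot>\<^sub>v (D *\<^sub>v u + q))
      @\<^sub>v Matrix.vec 1 (\<lambda>_. t\<^sup>2 - u \<bullet> u))"

definition SOL_MixCP ::
  "(nat \<Rightarrow> 'n) \<Rightarrow> nat \<Rightarrow> nat \<Rightarrow>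
   (real Matrix.vec \<Rightarrow> real Matrix.vec \<Rightarrow> real \<Rightarrow> real Matrix.vec) \<Rightarrow>
   (real Matrix.vec \<Rightarrow> real Matrix.vec \<Rightarrow> real \<Rightarrow> real Matrix.vec) \<Rightarrow> (real ^ 'n) set" where
  "SOL_MixCP ix k l G1 G2 =
     {z. let x = x_part ix k z; u = u_part ix k l z; t = t_part ix k l z in
         G2 x u t = 0\<^sub>v (l + 1) \<and> 0\<^sub>v k \<le> x \<and> 0\<^sub>v k \<le> G1 x u t \<and> x \<bullet> G1 x u t = 0}"

definition fischer_burmeister :: "real \<Rightarrow> real \<Rightarrow> real" where
  "fischer_burmeister a b = sqrt (a\<^sup>2 + b\<^sup>2) - (a + b)"

definition FB_map ::
  "(nat \<Rightarrow> 'n) \<Rightarrow> nat \<Rightarrow> nat \<Rightarrow>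
   (real Matrix.vec \<Rightarrow> real Matrix.vec \<Rightarrow> real \<Rightarrow> real Matrix.vec) \<Rightarrow>
   (real Matrix.vec \<Rightarrow> real Matrix.vec \<Rightarrow> real \<Rightarrow> real Matrix.vec) \<Rightarrow>
   real ^ 'n \<Rightarrow> real ^ 'n" where
  "FB_map ix k l G1 G2 z =
     (let x = x_part ix k z; u = u_part ix k l z; t = t_part ix k l z in
      of_coords ix (k + l + 1)
        (Matrix.vec k (\<lambda>i. fischer_burmeister (x $ i) (G1 x u t $ i)) @\<^sub>v G2 x u t))"

text \<open>
  The iterates are total functions of the starting point; they are the Newton iterates
  proper as long as \<open>F\<close> is differentiable with invertible Jacobian at each of them.
\<close>

primrec newton :: "(real ^ 'n \<Rightarrow> real ^ 'n) \<Rightarrow> real ^ 'n \<Rightarrow> nat \<Rightarrow> real ^ 'n" where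
  "newton F z0 0 = z0"
| "newton F z0 (Suc j) =
     newton F z0 j - matrix_inv (jacobian F (at (newton F z0 j))) *v F (newton F z0 j)"

definition newton_well_defined :: "(real ^ 'n \<Rightarrow> real ^ 'n) \<Rightarrow> real ^ 'n \<Rightarrow> bool" where
  "newton_well_defined F z0 \<longleftrightarrow>
     (\<forall>j. F differentiable (at (newton F z0 j)) \<and>
          invertible (jacobian F (at (newton F z0 j))))"

end

theory Submission
  imports Defs
begin

text \<open>
  At a solution where no pair \<open>(x\<^sub>i, F\<^sub>1\<^sup>i)\<close> vanishes, the radicands of the Fischer-Burmeister
  functions are positive, so every component of the map is twice differentiable there.
  Hence its Jacobian exists nearby and differs from the Jacobian at the solution by at most a
  constant times the distance, which is enough for the classical local analysis of Newton's
  method.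
\<close>

section \<open>Twice differentiability at a point and its closure properties\<close>

text \<open>The first derivative is represented by a gradient field \<open>g\<close>, so that the
  second derivative is just the derivative of a vector-valued function. It is required only at
  \<open>a\<close> itself, and no continuity is asked of it: this already bounds
  \<open>g x - g a\<close> by a multiple of the distance.\<close>

definition twice_differentiable_at :: "('a::real_inner \<Rightarrow> real) \<Rightarrow> 'a \<Rightarrow> bool" where
  "twice_differentiable_at f a \<longleftrightarrow>
     (\<exists>g. (\<forall>\<^sub>F x in nhds a. (f has_derivative inner (g x)) (at x)) \<and> g differentiable (at a))"

lemma twice_differentiable_atI:
  assumes "\<forall>\<^sub>F x in nhds a. (f has_derivative inner (g x)) (at x)" "g differentiable (at a)"
  shows "twice_differentiable_at f a"
  using assms by (auto simp: twice_differentiable_at_def)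

text \<open>The gradients of products and square roots contain the functions themselves as factors,
  so first-order differentiability is needed to differentiate those gradients.\<close>

lemma twice_differentiable_at_imp_differentiable:
  assumes "twice_differentiable_at f a"
  shows "f differentiable (at a)"
proof -
  obtain g where "\<forall>\<^sub>F x in nhds a. (f has_derivative inner (g x)) (at x)"
    using assms by (auto simp: twice_differentiable_at_def)
  then have "(f has_derivative inner (g a)) (at a)"
    by (rule eventually_nhds_x_imp_x)
  then show ?thesis
    by (rule differentiableI)
qed

lemma twice_differentiable_at_const: "twice_differentiable_at (\<lambda>x. c) (a :: 'a :: real_inner)"
proof (rule twice_differentiable_atI)
  have "((\<lambda>x. c) has_derivative inner 0) (at x)" for x :: 'a
    using has_derivative_const[of c "at x"] by (simp add: inner_zero_left[abs_def])
  then show "\<forall>\<^sub>F x in nhds a. ((\<lambda>x. c) has_derivative inner 0) (at x)"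
    by simp
qed simp

lemma twice_differentiable_at_nth:
  "twice_differentiable_at (\<lambda>z. vec_nth z i) (a :: real ^ 'n)"
proof (rule twice_differentiable_atI[where g = "\<lambda>_. axis i 1"])
  have "inner (axis i 1 :: real ^ 'n) = (\<lambda>h. vec_nth h i)"
    by (auto simp: inner_axis' fun_eq_iff)
  then show "\<forall>\<^sub>F x in nhds a. ((\<lambda>z. vec_nth z i) has_derivative inner (axis i 1)) (at x)"
    by (simp add: bounded_linear_imp_has_derivative bounded_linear_vec_nth)
qed simp

lemma twice_differentiable_at_add:
  assumes "twice_differentiable_at f a" "twice_differentiable_at g a"
  shows "twice_differentiable_at (\<lambda>x. f x + g x) a"
proof -
  obtain f' g' where f: "\<forall>\<^sub>F x in nhds a. (f has_derivative inner (f' x)) (at x)"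
      "f' differentiable (at a)"
    and g: "\<forall>\<^sub>F x in nhds a. (g has_derivative inner (g' x)) (at x)"
      "g' differentiable (at a)"
    using assms by (auto simp: twice_differentiable_at_def)
  show ?thesis
  proof (rule twice_differentiable_atI)
    show "\<forall>\<^sub>F x in nhds a. ((\<lambda>x. f x + g x) has_derivative inner (f' x + g' x)) (at x)"
      using f(1) g(1)
      by eventually_elim (auto intro!: derivative_eq_intros simp: inner_add_left fun_eq_iff)
  qed (use f g in auto)
qed

lemma twice_differentiable_at_mult:
  assumes "twice_differentiable_at f a" "twice_differentiable_at g a"
  shows "twice_differentiable_at (\<lambda>x. f x * g x) a"
proof -
  obtain f' g' where f: "\<forall>\<^sub>F x in nhds a. (f has_derivative inner (f' x)) (at x)"
      "f' differentiable (at a)"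
    and g: "\<forall>\<^sub>F x in nhds a. (g has_derivative inner (g' x)) (at x)"
      "g' differentiable (at a)"
    using assms by (auto simp: twice_differentiable_at_def)
  show ?thesis
  proof (rule twice_differentiable_atI)
    show "\<forall>\<^sub>F x in nhds a.
        ((\<lambda>x. f x * g x) has_derivative inner (f x *\<^sub>R g' x + g x *\<^sub>R f' x)) (at x)"
      using f(1) g(1)
      by eventually_elim
        (auto intro!: derivative_eq_intros simp: inner_add_left fun_eq_iff)
    show "(\<lambda>x. f x *\<^sub>R g' x + g x *\<^sub>R f' x) differentiable (at a)"
      using assms[THEN twice_differentiable_at_imp_differentiable] f(2) g(2)
      by (intro differentiable_add differentiable_scaleR)
  qed
qed

lemma twice_differentiable_at_power2:
  assumes "twice_differentiable_at f a"
  shows "twice_differentiable_at (\<lambda>x. (f x)\<^sup>2) a"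
  using twice_differentiable_at_mult[OF assms assms] by (simp add: power2_eq_square)

lemma twice_differentiable_at_diff:
  assumes "twice_differentiable_at f a" "twice_differentiable_at g a"
  shows "twice_differentiable_at (\<lambda>x. f x - g x) a"
  using twice_differentiable_at_add[OF assms(1)
      twice_differentiable_at_mult[OF twice_differentiable_at_const[of "- 1"] assms(2)]]
  by simp

lemma twice_differentiable_at_sum:
  assumes "\<And>i. i \<in> S \<Longrightarrow> twice_differentiable_at (f i) a"
  shows "twice_differentiable_at (\<lambda>x. \<Sum>i\<in>S. f i x) a"
  using assms
  by (induction S rule: infinite_finite_induct)
    (auto intro: twice_differentiable_at_const twice_differentiable_at_add)

text \<open>By continuity \<open>f\<close> stays positive near \<open>a\<close>, where the chain
  rule gives the gradient of the root as a scalar factor times \<open>f'\<close>. Both factors are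
  differentiable at \<open>a\<close>.\<close>

lemma twice_differentiable_at_sqrt:
  assumes "twice_differentiable_at f a" "f a > 0"
  shows "twice_differentiable_at (\<lambda>x. sqrt (f x)) a"
proof -
  obtain f' where f: "\<forall>\<^sub>F x in nhds a. (f has_derivative inner (f' x)) (at x)"
      "f' differentiable (at a)"
    using assms by (auto simp: twice_differentiable_at_def)
  obtain D where D: "(f has_derivative D) (at a)"
    using twice_differentiable_at_imp_differentiable[OF assms(1)] by (auto simp: differentiable_def)
  have "isCont f a"
    using D by (rule has_derivative_continuous)
  then have pos: "\<forall>\<^sub>F x in nhds a. f x > 0"
    using assms(2) order_tendstoD(1) by (auto simp: isCont_def tendsto_at_iff_tendsto_nhds)
  show ?thesis
  proof (rule twice_differentiable_atI)
    show "\<forall>\<^sub>F x in nhds a.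
        ((\<lambda>x. sqrt (f x)) has_derivative inner ((inverse (sqrt (f x)) / 2) *\<^sub>R f' x)) (at x)"
      using f(1) pos
      by eventually_elim (auto intro!: derivative_eq_intros simp: fun_eq_iff field_simps)
    have "((\<lambda>x. sqrt (f x)) has_derivative (\<lambda>h. D h * (inverse (sqrt (f a)) / 2))) (at a)"
      using D assms(2) by (auto intro!: derivative_eq_intros)
    then have "(\<lambda>x. sqrt (f x)) differentiable (at a)"
      by (auto simp: differentiable_def)
    then have "(\<lambda>x. inverse (sqrt (f x)) / 2) differentiable (at a)"
      using assms(2)
      by (intro differentiable_divide differentiable_inverse differentiable_const) auto
    then show "(\<lambda>x. (inverse (sqrt (f x)) / 2) *\<^sub>R f' x) differentiable (at a)"
      using f(2) by (intro differentiable_scaleR)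
  qed
qed

lemmas twice_differentiable_at_intros =
  twice_differentiable_at_const twice_differentiable_at_nth twice_differentiable_at_add
  twice_differentiable_at_diff twice_differentiable_at_mult twice_differentiable_at_power2
  twice_differentiable_at_sum

section \<open>Local Lipschitz bounds, Jacobians and invertible matrices\<close>

text \<open>Near \<open>a\<close> the remainder of the linear approximation is at most
  \<open>norm (x - a)\<close>, and the linear part contributes at most \<open>onorm D\<close> times
  this distance.\<close>

lemma differentiable_imp_locally_lipschitz_at:
  assumes "g differentiable (at a)"
  shows "\<exists>K. \<forall>\<^sub>F x in nhds a. norm (g x - g a) \<le> K * norm (x - a)"
proof -
  obtain D where D: "(g has_derivative D) (at a)"
    using assms by (auto simp: differentiable_def)
  then have lin: "bounded_linear D"
    by (rule has_derivative_bounded_linear)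
  obtain d where d: "d > 0"
      "\<And>y. norm (y - a) < d \<Longrightarrow> norm (g y - g a - D (y - a)) \<le> 1 * norm (y - a)"
    using D[unfolded has_derivative_at_alt, THEN conjunct2, rule_format, of 1] by auto
  have "norm (g x - g a) \<le> (1 + onorm D) * norm (x - a)" if "dist x a < d" for x
    using d(2)[of x] onorm[OF lin, of "x - a"] that
      norm_triangle_sub[of "g x - g a" "D (x - a)"]
    by (simp add: dist_norm algebra_simps)
  then show ?thesis
    using d(1) unfolding eventually_nhds_metric by blast
qed

lemma jacobian_eq:
  fixes f :: "real ^ 'n \<Rightarrow> real ^ 'm"
  assumes "(f has_derivative (*v) J) (at x)"
  shows "jacobian f (at x) = J"
  using matrix_of_matrix_vector_mul[of J]
  by (simp add: jacobian_def frechet_derivative_at[OF assms, symmetric])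

lemma invertible_mult_matrix_inv:
  fixes M :: "real ^ 'n ^ 'm"
  assumes "invertible M"
  shows "M ** matrix_inv M = Finite_Cartesian_Product.mat 1"
  using someI_ex[OF assms[unfolded invertible_def]] by (simp add: matrix_inv_def)

text \<open>An injective linear map on a finite-dimensional space is bounded below. Such a bound
  survives small perturbations of the matrix, so together with the next lemma it carries
  nonsingularity over to nearby Jacobians.\<close>

lemma invertible_imp_norm_bound:
  fixes M :: "real ^ 'n ^ 'n"
  assumes "invertible M"
  obtains b where "b > 0" "\<And>h. b * norm h \<le> norm (M *v h)"
proof -
  have "inj ((*v) M)"
    using assms by (simp add: invertible_left_inverse matrix_left_invertible_injective)
  then show ?thesis
    using linear_inj_bounded_below_pos[of "(*v) M"] that by auto
qed

lemma norm_bound_imp_invertible: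
  fixes M :: "real ^ 'n ^ 'n"
  assumes "b > 0" "\<And>h. b * norm h \<le> norm (M *v h)"
  shows "invertible M"
proof -
  have "h = 0" if "M *v h = 0" for h
    using assms(2)[of h] assms(1) that by (simp add: mult_le_0_iff)
  then show ?thesis
    by (metis invertible_left_inverse matrix_left_invertible_ker)
qed

section \<open>Local quadratic convergence of Newton's method\<close>

text \<open>
  A Lipschitz condition between \<open>J x\<close> and \<open>J a\<close> suffices: the error of a Newton step solves
  \<open>J x (x' - a) = (J x - J a) (x - a) - (f x - f a - J a (x - a))\<close>.
\<close>

lemma newton_step_quadratic:
  fixes f :: "real ^ 'n \<Rightarrow> real ^ 'n" and J :: "real ^ 'n \<Rightarrow> real ^ 'n ^ 'n"
  assumes "r > 0" "L \<ge> 0"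
    and deriv: "\<And>x. norm (x - a) < r \<Longrightarrow> (f has_derivative (*v) (J x)) (at x)"
    and lip: "\<And>x h. norm (x - a) < r \<Longrightarrow> norm (J x *v h - J a *v h) \<le> L * norm (x - a) * norm h"
    and "f a = 0" "invertible (J a)"
  shows "\<exists>s>0. \<exists>c>0. \<forall>x. norm (x - a) < s \<longrightarrow>
           f differentiable (at x) \<and> invertible (jacobian f (at x)) \<and>
           norm (x - matrix_inv (jacobian f (at x)) *v f x - a) \<le> c * (norm (x - a))\<^sup>2"
proof -
  obtain b where b: "b > 0" "\<And>h. b * norm h \<le> norm (J a *v h)"
    using invertible_imp_norm_bound[OF assms(6)] by blast
  \<comment> \<open>The choice gives \<open>L * s \<le> b / 2\<close>, so within distance
    \<open>s\<close> the Jacobian loses at most half of the lower bound \<open>b\<close>. Using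
    \<open>L + 1\<close> keeps \<open>s\<close> positive when \<open>L = 0\<close>.\<close>
  define s where "s = min r (b / (2 * (L + 1)))"
  have s: "s > 0" "s \<le> r" "L * s \<le> b / 2"
  proof -
    have "L * s \<le> (L + 1) * (b / (2 * (L + 1)))"
      using assms(2) b(1) \<open>r > 0\<close> by (intro mult_mono) (auto simp: s_def)
    also have "\<dots> = b / 2"
      using assms(2) nonzero_mult_divide_mult_cancel_left[of "L + 1" b 2]
      by (simp add: mult.commute)
    finally show "L * s \<le> b / 2" .
  qed (use assms(1,2) b(1) in \<open>auto simp: s_def\<close>)
  \<comment> \<open>The estimate below yields the factor \<open>4 * L / b\<close>; adding 1 makes
    \<open>c\<close> positive even when \<open>L = 0\<close>.\<close>
  define c where "c = 4 * L / b + 1"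
  have "c > 0"
    using assms(2) b(1) by (simp add: c_def add_nonneg_pos)
  have "f differentiable (at x) \<and> invertible (jacobian f (at x)) \<and>
        norm (x - matrix_inv (jacobian f (at x)) *v f x - a) \<le> c * (norm (x - a))\<^sup>2"
    if x: "norm (x - a) < s" for x
  proof -
    have xr: "norm (x - a) < r"
      using x s by simp
    have Jx: "jacobian f (at x) = J x"
      by (rule jacobian_eq[OF deriv[OF xr]])
    have below: "b / 2 * norm h \<le> norm (J x *v h)" for h
    proof -
      have "L * norm (x - a) * norm h \<le> b / 2 * norm h"
        using x s assms(2) by (intro mult_right_mono order_trans[OF mult_left_mono s(3)]) auto
      then have "norm (J x *v h - J a *v h) \<le> b / 2 * norm h"
        using lip[OF xr] order_trans by blast
      then show ?thesis
        using b(2)[of h] norm_triangle_ineq3[of "J a *v h" "J x *v h"]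
        by (simp add: norm_minus_commute)
    qed
    have inv: "invertible (J x)"
      using below b(1) by (intro norm_bound_imp_invertible[of "b / 2"]) auto
    define d where "d = norm (x - a)"
    have taylor: "norm (f x - f a - J a *v (x - a)) \<le> L * d * d"
    proof -
      \<comment> \<open>Mean value inequality for \<open>f\<close> minus its linear part at
        \<open>a\<close>: on the ball of radius \<open>d\<close> the derivative
        \<open>J y - J a\<close> has operator norm at most \<open>L * d\<close>.\<close>
      have "norm ((f x - J a *v x) - (f a - J a *v a)) \<le> L * d * norm (x - a)"
      proof (rule differentiable_bound[where S = "cball a d" and f' = "\<lambda>y h. J y *v h - J a *v h"])
        fix y assume "y \<in> cball a d"
        then have y: "norm (y - a) \<le> d" "norm (y - a) < r"
          using xr by (auto simp: dist_norm norm_minus_commute d_def)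
        show "((\<lambda>x. f x - J a *v x) has_derivative (\<lambda>h. J y *v h - J a *v h)) (at y within cball a d)"
          by (intro has_derivative_diff has_derivative_at_withinI[OF deriv[OF y(2)]]
              bounded_linear_imp_has_derivative matrix_vector_mul_bounded_linear)
        show "onorm (\<lambda>h. J y *v h - J a *v h) \<le> L * d"
        proof (rule onorm_le)
          fix h
          show "norm (J y *v h - J a *v h) \<le> L * d * norm h"
            using lip[OF y(2), of h] y(1) assms(2)
            by (meson order_trans mult_right_mono mult_left_mono norm_ge_zero)
        qed
      qed (auto simp: d_def dist_norm norm_minus_commute)
      then show ?thesis
        by (simp add: d_def algebra_simps matrix_vector_mult_diff_distrib)
    qed
    define w where "w = x - matrix_inv (J x) *v f x - a"
    have "J x *v w = J x *v (x - a) - f x"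
      using inv
      by (simp add: w_def matrix_vector_mult_diff_distrib matrix_vector_mul_assoc
          invertible_mult_matrix_inv algebra_simps)
    \<comment> \<open>Since \<open>f a = 0\<close>, it may be inserted together with
      \<open>J a *v (x - a)\<close>. This splits the error into the change of the Jacobian and the
      Taylor remainder, each at most \<open>L * d * d\<close>.\<close>
    also have "\<dots> = (J x *v (x - a) - J a *v (x - a)) - (f x - f a - J a *v (x - a))"
      by (simp add: assms(5))
    finally have "norm (J x *v w) \<le>
        norm (J x *v (x - a) - J a *v (x - a)) + norm (f x - f a - J a *v (x - a))"
      by (simp only: norm_triangle_ineq4)
    also have "\<dots> \<le> L * d * d + L * d * d"
      using lip[OF xr, of "x - a"] taylor by (intro add_mono) (simp_all add: d_def)
    finally have "norm (J x *v w) \<le> L * d * d + L * d * d" .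
    then have "b / 2 * norm w \<le> 2 * L * d\<^sup>2"
      using below[of w] by (simp add: power2_eq_square)
    then have "norm w \<le> 4 * L / b * d\<^sup>2"
      using b(1) by (simp add: field_simps)
    also have "\<dots> \<le> c * d\<^sup>2"
      by (simp add: c_def algebra_simps)
    finally show ?thesis
      using deriv[OF xr] inv Jx by (auto simp: w_def d_def differentiable_def)
  qed
  then show ?thesis
    using s(1) \<open>c > 0\<close> by blast
qed

text \<open>The gradients of the components are the rows of the Jacobian and provide its Lipschitz
  bound at \<open>a\<close>. Close to \<open>a\<close> a quadratic step at least halves the
  distance, so the iterates stay where the one-step estimate is valid and converge.\<close>

lemma newton_converges_quadratically:
  fixes f :: "real ^ 'n \<Rightarrow> real ^ 'n"
  assumes smooth: "\<And>i. twice_differentiable_at (\<lambda>z. vec_nth (f z) i) a"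
    and "f a = 0" "invertible (jacobian f (at a))"
  shows "\<exists>\<rho>>0. \<exists>c>0. \<forall>z0. norm (z0 - a) < \<rho> \<longrightarrow>
           newton_well_defined f z0 \<and>
           newton f z0 \<longlonglongrightarrow> a \<and>
           (\<forall>j. norm (newton f z0 (Suc j) - a) \<le> c * (norm (newton f z0 j - a))\<^sup>2)"
proof -
  have "\<forall>i. \<exists>g. (\<forall>\<^sub>F x in nhds a. ((\<lambda>z. vec_nth (f z) i) has_derivative inner (g x)) (at x)) \<and>
      g differentiable (at a)"
    using smooth by (simp add: twice_differentiable_at_def)
  from choice[OF this] obtain g where
    g: "\<And>i. \<forall>\<^sub>F x in nhds a. ((\<lambda>z. vec_nth (f z) i) has_derivative inner (g i x)) (at x)"
      "\<And>i. g i differentiable (at a)"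
    by blast
  obtain K where K: "\<And>i. \<forall>\<^sub>F x in nhds a. norm (g i x - g i a) \<le> K i * norm (x - a)"
    using differentiable_imp_locally_lipschitz_at[OF g(2)] by metis
  define J :: "real ^ 'n \<Rightarrow> real ^ 'n ^ 'n" where "J x = vec_lambda (\<lambda>i. g i x)" for x
  have J: "vec_nth (J x *v h) i = inner (g i x) h" for x h i
    by (simp add: J_def matrix_vector_mul_component)
  \<comment> \<open>There are finitely many components, so one radius serves them all.\<close>
  have "\<forall>\<^sub>F x in nhds a. \<forall>i. ((\<lambda>z. vec_nth (f z) i) has_derivative inner (g i x)) (at x) \<and>
          norm (g i x - g i a) \<le> K i * norm (x - a)"
    using g(1) K by (intro eventually_all_finite eventually_conj)
  then obtain r where r: "r > 0"
    "\<And>x i. norm (x - a) < r \<Longrightarrow> ((\<lambda>z. vec_nth (f z) i) has_derivative inner (g i x)) (at x)"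
    "\<And>x i. norm (x - a) < r \<Longrightarrow> norm (g i x - g i a) \<le> K i * norm (x - a)"
    unfolding eventually_nhds_metric dist_norm by metis
  have deriv: "(f has_derivative (*v) (J x)) (at x)" if "norm (x - a) < r" for x
    unfolding has_derivative_componentwise_within[of f] Basis_vec_def
    using r(2)[OF that] by (auto simp: inner_axis J)
  \<comment> \<open>The Euclidean norm is bounded by the sum of the absolute coordinates, so the
    constants add up. Absolute values are taken because the sign of \<open>K i\<close> is
    unknown.\<close>
  define L where "L = (\<Sum>i\<in>UNIV. \<bar>K i\<bar>)"
  have lip: "norm (J x *v h - J a *v h) \<le> L * norm (x - a) * norm h" if "norm (x - a) < r" for x h
  proof -
    have "norm (J x *v h - J a *v h) \<le> (\<Sum>i\<in>UNIV. \<bar>vec_nth (J x *v h - J a *v h) i\<bar>)"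
      by (rule norm_le_l1_cart)
    also have "\<dots> \<le> (\<Sum>i\<in>UNIV. \<bar>K i\<bar> * norm (x - a) * norm h)"
    proof (rule sum_mono)
      fix i
      have "\<bar>vec_nth (J x *v h - J a *v h) i\<bar> = \<bar>inner (g i x - g i a) h\<bar>"
        by (simp add: J inner_diff_left)
      also have "\<dots> \<le> norm (g i x - g i a) * norm h"
        by (rule Cauchy_Schwarz_ineq2)
      also have "\<dots> \<le> \<bar>K i\<bar> * norm (x - a) * norm h"
        by (intro mult_right_mono order_trans[OF r(3)[OF that, of i]]) auto
      finally show "\<bar>vec_nth (J x *v h - J a *v h) i\<bar> \<le> \<bar>K i\<bar> * norm (x - a) * norm h" .
    qed
    finally show ?thesis
      by (simp add: L_def sum_distrib_right)
  qed
  have "invertible (J a)"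
    using assms(3) jacobian_eq[OF deriv[of a]] r(1) by simp
  moreover have "L \<ge> 0"
    by (simp add: L_def sum_nonneg)
  ultimately obtain s c where sc: "s > 0" "c > 0" and
    step: "\<And>x. norm (x - a) < s \<Longrightarrow>
           f differentiable (at x) \<and> invertible (jacobian f (at x)) \<and>
           norm (x - matrix_inv (jacobian f (at x)) *v f x - a) \<le> c * (norm (x - a))\<^sup>2"
    using newton_step_quadratic[OF r(1) _ deriv lip assms(2)] by blast
  \<comment> \<open>Within distance \<open>1 / (2 * c)\<close> the bound
    \<open>c * d\<^sup>2\<close> is at most \<open>d / 2\<close>.\<close>
  define \<rho> where "\<rho> = min s (1 / (2 * c))"
  have \<rho>: "\<rho> > 0" "\<rho> \<le> s" "c * \<rho> \<le> 1 / 2"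
    using sc by (auto simp: \<rho>_def field_simps min_def)
  have "newton_well_defined f z \<and> newton f z \<longlonglongrightarrow> a \<and>
        (\<forall>j. norm (newton f z (Suc j) - a) \<le> c * (norm (newton f z j - a))\<^sup>2)"
    if z: "norm (z - a) < \<rho>" for z
  proof -
    \<comment> \<open>The geometric bound also keeps iterate \<open>j\<close> within \<rho> of
      \<open>a\<close>, which is what permits the next application of \<open>step\<close>.\<close>
    have half: "norm (newton f z j - a) \<le> (1 / 2) ^ j * norm (z - a)" for j
    proof (induction j)
      case (Suc j)
      let ?d = "norm (newton f z j - a)"
      have "(1 / 2) ^ j * norm (z - a) \<le> norm (z - a)"
        by (simp add: mult_left_le_one_le power_le_one)
      then have d: "?d < \<rho>"
        using Suc z by linarith
      then have "norm (newton f z (Suc j) - a) \<le> c * ?d * ?d"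
        using step[of "newton f z j"] \<rho>(2) by (simp add: power2_eq_square mult.assoc)
      also have "\<dots> \<le> 1 / 2 * ?d"
        using d sc(2) \<rho>(3) by (intro mult_right_mono order_trans[OF mult_left_mono \<rho>(3)]) auto
      also have "\<dots> \<le> (1 / 2) ^ Suc j * norm (z - a)"
        using Suc by simp
      finally show ?case .
    qed simp
    have near: "norm (newton f z j - a) < s" for j
    proof -
      have "(1 / 2) ^ j * norm (z - a) \<le> norm (z - a)"
        by (simp add: mult_left_le_one_le power_le_one)
      then show ?thesis
        using half[of j] z \<rho>(2) by linarith
    qed
    have "(\<lambda>j. newton f z j - a) \<longlonglongrightarrow> 0"
    proof (rule Lim_null_comparison)
      show "\<forall>\<^sub>F j in sequentially. norm (newton f z j - a) \<le> (1 / 2) ^ j * norm (z - a)"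
        using half by simp
      show "(\<lambda>j. (1 / 2) ^ j * norm (z - a)) \<longlonglongrightarrow> 0"
        by (intro tendsto_mult_left_zero LIMSEQ_realpow_zero) auto
    qed
    then show ?thesis
      using step[OF near] by (simp add: newton_well_defined_def LIM_zero_iff)
  qed
  then show ?thesis
    using \<rho>(1) sc(2) by blast
qed

section \<open>The Fischer-Burmeister function and the coordinates of the map\<close>

lemma fischer_burmeister_eq_0:
  assumes "a \<ge> 0" "b \<ge> 0" "a * b = 0"
  shows "fischer_burmeister a b = 0"
  using assms by (auto simp: fischer_burmeister_def)

text \<open>Away from the origin the radicand is positive, so the root causes no loss of
  smoothness.\<close>

lemma twice_differentiable_at_fischer_burmeister:
  assumes "twice_differentiable_at f a" "twice_differentiable_at g a" "(f a, g a) \<noteq> (0, 0)"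
  shows "twice_differentiable_at (\<lambda>x. fischer_burmeister (f x) (g x)) a"
proof -
  have "(f a)\<^sup>2 + (g a)\<^sup>2 > 0"
    using assms(3) by (auto simp: sum_power2_gt_zero_iff)
  then show ?thesis
    unfolding fischer_burmeister_def using assms(1,2)
    by (intro twice_differentiable_at_intros twice_differentiable_at_sqrt)
qed

lemma of_coords_nth:
  assumes "inj_on ix {..<d}" "j < d"
  shows "vec_nth (of_coords ix d v) (ix j) = v $ j"
  using assms by (simp add: of_coords_def the_inv_into_f_f)

text \<open>This and the next two lemmas expand the matrix expressions into explicit polynomials in
  the coordinates, to which the closure rules for sums and products apply.\<close>

lemma F1_nth:
  assumes "A \<in> carrier_mat k k" "B \<in> carrier_mat k l" "p \<in> carrier_vec k"
    and "x \<in> carrier_vec k" "u \<in> carrier_vec l" "i < k"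
  shows "F1 A B p x u t $ i =
    (\<Sum>j = 0..<k. A $$ (i, j) * (x $ j + t)) + (\<Sum>j = 0..<l. B $$ (i, j) * u $ j) + p $ i"
  using assms by (auto simp: F1_def ones_def scalar_prod_def)

text \<open>The inner sum in the first line is entry \<open>(i, j)\<close> of
  \<open>u e^T A\<close>: the entry \<open>u $ i\<close> times column sum \<open>j\<close> of
  \<open>A\<close>.\<close>

lemma F2_nth:
  assumes "A \<in> carrier_mat k k" "B \<in> carrier_mat k l"
    and "C \<in> carrier_mat l k" "D \<in> carrier_mat l l"
    and "p \<in> carrier_vec k" "q \<in> carrier_vec l"
    and "x \<in> carrier_vec k" "u \<in> carrier_vec l" "i < l"
  shows "F2 A B C D p q x u t $ i =
    (\<Sum>j = 0..<k. (t * C $$ (i, j) + (\<Sum>n = 0..<k. u $ i * A $$ (n, j))) * (x $ j + t)) +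
    (\<Sum>n = 0..<k. u $ i * ((\<Sum>j = 0..<l. B $$ (n, j) * u $ j) + p $ n)) +
    t * ((\<Sum>j = 0..<l. D $$ (i, j) * u $ j) + q $ i)"
  using assms by (auto simp: F2_def Let_def ones_def outer_def scalar_prod_def)

lemma F2_nth_last:
  assumes "C \<in> carrier_mat l k" "D \<in> carrier_mat l l" "q \<in> carrier_vec l" "u \<in> carrier_vec l"
  shows "F2 A B C D p q x u t $ l = t\<^sup>2 - (\<Sum>j = 0..<l. u $ j * u $ j)"
  using assms by (auto simp: F2_def Let_def outer_def scalar_prod_def)

section \<open>Newton's method for the complementarity problem\<close>

theorem theorem3:
  fixes k l :: nat
    and A B C D :: "real Matrix.mat"
    and p q :: "real Matrix.vec"
    and ix :: "nat \<Rightarrow> 'n::finite"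
    and zs :: "real ^ 'n"
  defines "G1 \<equiv> F1 A B p"
    and "G2 \<equiv> F2 A B C D p q"
  defines "F \<equiv> FB_map ix k l G1 G2"
  assumes "A \<in> carrier_mat k k" "B \<in> carrier_mat k l"
    and "C \<in> carrier_mat l k" "D \<in> carrier_mat l l"
    and "p \<in> carrier_vec k" "q \<in> carrier_vec l"
    and "bij_betw ix {..<k + l + 1} (UNIV :: 'n set)"
    and "zs \<in> SOL_MixCP ix k l G1 G2"
    and "\<And>i. i < k \<Longrightarrow>
           (x_part ix k zs $ i, G1 (x_part ix k zs) (u_part ix k l zs) (t_part ix k l zs) $ i)
             \<noteq> (0, 0)"
    and "invertible (jacobian F (at zs))"
  shows "\<exists>\<rho>>0. \<exists>c>0. \<forall>z0. norm (z0 - zs) < \<rho> \<longrightarrow>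
           newton_well_defined F z0 \<and>
           newton F z0 \<longlonglongrightarrow> zs \<and>
           (\<forall>j. norm (newton F z0 (Suc j) - zs) \<le> c * (norm (newton F z0 j - zs))\<^sup>2)"
proof -
  note dims = assms(4-9)
  have x_dim: "x_part ix k z \<in> carrier_vec k" and u_dim: "u_part ix k l z \<in> carrier_vec l" for z
    by (auto simp: x_part_def u_part_def)
  have G1_dim: "dim_vec (G1 x u t) = k" and G2_dim: "dim_vec (G2 x u t) = l + 1"
    if "dim_vec u = l" for x u t
    using dims that by (auto simp: G1_def G2_def F1_def F2_def Let_def outer_def)
  have inj: "inj_on ix {..<k + l + 1}" and surj: "ix ` {..<k + l + 1} = UNIV"
    using assms(10) by (auto simp: bij_betw_def)
  have comp_x: "vec_nth (F z) (ix j) = fischer_burmeister (x_part ix k z $ j)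
      (G1 (x_part ix k z) (u_part ix k l z) (t_part ix k l z) $ j)" if "j < k" for j z
    using that u_dim[of z]
    unfolding F_def FB_map_def Let_def by (subst of_coords_nth[OF inj]) (auto simp: G2_dim)
  have comp_u: "vec_nth (F z) (ix (k + j)) =
      G2 (x_part ix k z) (u_part ix k l z) (t_part ix k l z) $ j" if "j < l + 1" for j z
    using that u_dim[of z]
    unfolding F_def FB_map_def Let_def by (subst of_coords_nth[OF inj]) (auto simp: G2_dim)
  \<comment> \<open>A case rule for the coordinates of \<open>F\<close>: the first \<open>k\<close>
    are Fischer-Burmeister values, the remaining \<open>l + 1\<close> come from
    \<open>G2\<close>.\<close>
  have index_cases: thesis
    if "\<And>j. j < k \<Longrightarrow> i = ix j \<Longrightarrow> thesis" "\<And>j. j < l + 1 \<Longrightarrow> i = ix (k + j) \<Longrightarrow> thesis"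
    for i thesis
  proof -
    obtain j where j: "j < k + l + 1" "i = ix j"
      using surj by blast
    show thesis
    proof (cases "j < k")
      case False
      then show thesis
        using that(2)[of "j - k"] j by auto
    qed (use that j in blast)
  qed
  have td_x: "twice_differentiable_at (\<lambda>z. x_part ix k z $ j) a" if "j < k" for j a
    using that by (simp add: x_part_def twice_differentiable_at_nth)
  have td_u: "twice_differentiable_at (\<lambda>z. u_part ix k l z $ j) a" if "j < l" for j a
    using that by (simp add: u_part_def twice_differentiable_at_nth)
  have td_t: "twice_differentiable_at (\<lambda>z. t_part ix k l z) a" for a
    by (simp add: t_part_def twice_differentiable_at_nth)
  note td = td_x td_u td_t twice_differentiable_at_intros
  have td_G1: "twice_differentiable_at
      (\<lambda>z. G1 (x_part ix k z) (u_part ix k l z) (t_part ix k l z) $ j) a" if "j < k" for j a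
    unfolding G1_def F1_nth[OF dims(1,2,5) x_dim u_dim that] by (intro td) auto
  have td_G2: "twice_differentiable_at
      (\<lambda>z. G2 (x_part ix k z) (u_part ix k l z) (t_part ix k l z) $ j) a" if "j < l + 1" for j a
  \<comment> \<open>Index \<open>l\<close> is the appended scalar component
    \<open>t^2 - |u|^2\<close>, which has its own expansion.\<close>
  proof (cases "j = l")
    case True
    then show ?thesis
      unfolding G2_def True F2_nth_last[OF dims(3,4,6) u_dim] by (intro td) auto
  next
    case False
    then have "j < l"
      using that by simp
    then show ?thesis
      unfolding G2_def F2_nth[OF dims x_dim u_dim \<open>j < l\<close>] by (intro td) auto
  qed
  have "twice_differentiable_at (\<lambda>z. vec_nth (F z) i) zs" for i
  proof (cases i rule: index_cases)
    case (1 j)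
    \<comment> \<open>Here the assumption that no pair vanishes at \<open>zs\<close> enters; it
      makes the radicand positive.\<close>
    then show ?thesis
      unfolding 1(2) comp_x[OF 1(1)]
      by (intro twice_differentiable_at_fischer_burmeister td_x td_G1 assms(12))
  next
    case (2 j)
    then show ?thesis
      unfolding 2(2) comp_u[OF 2(1)] by (intro td_G2)
  qed
  moreover have "F zs = 0"
  proof -
    define x u t where "x = x_part ix k zs" and "u = u_part ix k l zs" and "t = t_part ix k l zs"
    have dim: "dim_vec x = k" "dim_vec (G1 x u t) = k"
      using x_dim[of zs] u_dim[of zs] by (auto simp: x_def u_def G1_dim)
    have sol: "G2 x u t = 0\<^sub>v (l + 1)" "0\<^sub>v k \<le> x" "0\<^sub>v k \<le> G1 x u t" "x \<bullet> G1 x u t = 0"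
      using assms(11) by (auto simp: SOL_MixCP_def Let_def x_def u_def t_def)
    have nonneg: "x $ j \<ge> 0" "G1 x u t $ j \<ge> 0" if "j < k" for j
      using sol(2,3) that dim by (auto simp: less_eq_vec_def)
    have "(\<Sum>j = 0..<k. x $ j * G1 x u t $ j) = 0"
      using sol(4) dim by (simp add: scalar_prod_def)
    \<comment> \<open>A vanishing sum of nonnegative terms has only zero terms, so orthogonality
      becomes complementarity of each pair, and each Fischer-Burmeister value is zero.\<close>
    then have "\<forall>j\<in>{0..<k}. x $ j * G1 x u t $ j = 0"
      using nonneg by (subst (asm) sum_nonneg_eq_0_iff) auto
    then have "vec_nth (F zs) i = 0" for i
      by (cases i rule: index_cases)
        (use nonneg sol(1) in \<open>auto simp: comp_x comp_u fischer_burmeister_eq_0 x_def u_def t_def\<close>)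
    then show ?thesis
      by (simp add: Finite_Cartesian_Product.vec_eq_iff)
  qed
  ultimately show ?thesis
    using assms(13) by (intro newton_converges_quadratically)
qed

end
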